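(* Let $R$ be an associative ring, let $\alpha : R\to R$ be a ring automorphism, and let $D : R\to R$ be an $(\alpha,\alpha)$-symmetric derivation. Then for every positive integer $n$, $D([x,y]^{n+1}) = 0$ for all $x,y\in R$.
   Context: Rings are associative and not assumed to be unital or commutative. $[x,y]$ denotes $xy-yx$. An additive map $D : R\to R$ is an $(\alpha,\alpha)$-derivation if $D(xy) = D(x)\alpha(y)+\alpha(x)D(y)$ for all $x,y\in R$. An additive $(\alpha,\alpha)$-derivation $D$ is an $(\alpha,\alpha)$-symmetric derivation if $D(xy) = D(yx)$ for all $x,y\in R$. *)

theory Defs
  imports Complex_Main
begin

text \<open>
  Rings are modelled by the type class \<open>ring\<close>, which is associative but requires neither a
  unit nor commutativity.
\<close>

definition commutator :: "'a::ring \<Rightarrow> 'a \<Rightarrow> 'a" where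
  "commutator x y = x * y - y * x"

text \<open>
  The library power \<open>x ^ n\<close> requires a unit. In a ring without unit \<open>x\<^sup>n\<close> only makes
  sense for \<open>n \<ge> 1\<close>; the value at \<open>n = 0\<close> is junk.
\<close>

definition pos_power :: "'a::ring \<Rightarrow> nat \<Rightarrow> 'a" where
  "pos_power x n = (((*) x) ^^ (n - 1)) x"

lemma pos_power_1: "pos_power x 1 = x"
  by (simp add: pos_power_def)

lemma pos_power_Suc: "n \<ge> 1 \<Longrightarrow> pos_power x (Suc n) = x * pos_power x n"
  by (cases n) (simp_all add: pos_power_def)

definition ring_automorphism :: "('a::ring \<Rightarrow> 'a) \<Rightarrow> bool" where
  "ring_automorphism \<alpha> \<longleftrightarrow>
     additive \<alpha> \<and> (\<forall>x y. \<alpha> (x * y) = \<alpha> x * \<alpha> y) \<and> bij \<alpha>"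

definition twisted_derivation :: "('a::ring \<Rightarrow> 'a) \<Rightarrow> ('a \<Rightarrow> 'a) \<Rightarrow> bool" where
  "twisted_derivation \<alpha> D \<longleftrightarrow>
     additive D \<and> (\<forall>x y. D (x * y) = D x * \<alpha> y + \<alpha> x * D y)"

definition symmetric_derivation :: "('a::ring \<Rightarrow> 'a) \<Rightarrow> ('a \<Rightarrow> 'a) \<Rightarrow> bool" where
  "symmetric_derivation \<alpha> D \<longleftrightarrow>
     twisted_derivation \<alpha> D \<and> (\<forall>x y. D (x * y) = D (y * x))"

end

theory Submission
  imports Defs
begin

text \<open>Symmetry and additivity make \<open>D\<close> vanish on every commutator
  (\<open>symmetric_derivation_commutator\<close>). The twisted Leibniz rule carries a zero of
  \<open>D\<close> over to all its positive powers (\<open>twisted_derivation_pos_power\<close>), in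
  particular to the powers of a commutator.\<close>

lemma symmetric_derivation_commutator:
  assumes "symmetric_derivation \<alpha> D"
  shows "D (commutator x y) = 0"
proof -
  have "additive D" and "D (x * y) = D (y * x)"
    using assms unfolding symmetric_derivation_def twisted_derivation_def by blast+
  then show ?thesis
    by (simp add: commutator_def additive.diff)
qed

lemma twisted_derivation_pos_power:
  assumes "twisted_derivation \<alpha> D" and "D x = 0" and "n \<ge> 1"
  shows "D (pos_power x n) = 0"
  using \<open>n \<ge> 1\<close>
\<comment> \<open>The induction starts at 1, since \<open>pos_power x 0\<close> is a junk
  value.\<close>
proof (induction n rule: dec_induct)
  case base
  then show ?case using \<open>D x = 0\<close> by (simp only: pos_power_1)
next
  case (step m)
  \<comment> \<open>In \<open>D x * \<alpha> (pos_power x m) + \<alpha> x * D (pos_power x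
    m)\<close> the first term vanishes by \<open>D x = 0\<close>, the second by induction.\<close>
  then show ?case using assms(1,2) by (simp add: pos_power_Suc twisted_derivation_def)
qed

theorem theorem3p2:
  fixes \<alpha> D :: "'a::ring \<Rightarrow> 'a"
  assumes "ring_automorphism \<alpha>"
    and "symmetric_derivation \<alpha> D"
  shows "\<forall>n::nat. n \<ge> 1 \<longrightarrow> (\<forall>x y. D (pos_power (commutator x y) (n + 1)) = 0)"
proof (intro allI impI)
  fix n :: nat and x y :: 'a
  have "twisted_derivation \<alpha> D"
    using assms(2) by (simp add: symmetric_derivation_def)
  then show "D (pos_power (commutator x y) (n + 1)) = 0"
    using symmetric_derivation_commutator[OF assms(2)]
    by (rule twisted_derivation_pos_power) simp
qed

end
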